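(* Let $n\geq 4$. Then $AQ_n$ is fractional strongly maximally matched and fractional strongly super matched; that is, $fsmp(AQ_n)=2n-1$, and for every $F\subseteq V(AQ_n)\cup E(AQ_n)$ with $|F|=2n-1$ such that $AQ_n-F$ has no fractional perfect matching, $AQ_n-F$ has an isolated vertex.
   Context: The $n$-dimensional augmented cube $AQ_n$ ($n\geq 1$) has vertex set all binary strings $u_1u_2\cdots u_n$. $AQ_1\cong K_2$ on vertices $0,1$. For $n\geq 2$, $AQ_n$ consists of a copy $AQ^0_{n-1}$ of $AQ_{n-1}$ with $0$ prefixed to every label and a copy $AQ^1_{n-1}$ with $1$ prefixed, plus the following edges: $0u_1\cdots u_{n-1}$ is adjacent to $1v_1\cdots v_{n-1}$ iff either $u_i=v_i$ for all $i$ (cross edge) or $u_i\neq v_i$ for all $i$ (complement edge). $AQ_n$ is $(2n-1)$-regular. For $F\subseteq V(G)\cup E(G)$, $G-F$ denotes $G$ with the vertices and edges of $F$ deleted. A fractional perfect matching of $G$ is $f:E(G)\to[0,1]$ with $\sum_{e\ni v}f(e)=1$ for every vertex $v$. A fractional strong matching preclusion (FSMP) set is $F\subseteq V(G)\cup E(G)$ with $G-F$ having no fractional perfect matching; $fsmp(G)$ is the minimum size of an FSMP set, and an FSMP set of that size is optimal. $G$ is fractional strongly maximally matched if $fsmp(G)=\delta(G)$, and fractional strongly super matched if in addition $G-F$ has an isolated vertex for every optimal FSMP set $F$. *)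

theory Defs
  imports Complex_Main
begin

text \<open>A graph is a pair (V, E) with V a vertex set and E a set of edges,
  each edge being a 2-element subset of V.  Fault sets F mix vertices
  (Inl v) and edges (Inr e).\<close>

definition fractional_perfect_matching ::
  "'a set \<Rightarrow> 'a set set \<Rightarrow> ('a set \<Rightarrow> real) \<Rightarrow> bool" where
  "fractional_perfect_matching V E f \<longleftrightarrow>
     (\<forall>e\<in>E. 0 \<le> f e \<and> f e \<le> 1) \<and>
     (\<forall>v\<in>V. (\<Sum>e\<in>{e\<in>E. v \<in> e}. f e) = 1)"

definition has_fpm :: "'a set \<Rightarrow> 'a set set \<Rightarrow> bool" where
  "has_fpm V E \<longleftrightarrow> (\<exists>f. fractional_perfect_matching V E f)"

definition del_verts :: "'a set \<Rightarrow> ('a + 'a set) set \<Rightarrow> 'a set" where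
  "del_verts V F = V - {v. Inl v \<in> F}"

definition del_edges :: "'a set \<Rightarrow> 'a set set \<Rightarrow> ('a + 'a set) set \<Rightarrow> 'a set set" where
  "del_edges V E F = {e\<in>E. Inr e \<notin> F \<and> e \<subseteq> del_verts V F}"

definition fsmp_set :: "'a set \<Rightarrow> 'a set set \<Rightarrow> ('a + 'a set) set \<Rightarrow> bool" where
  "fsmp_set V E F \<longleftrightarrow> F \<subseteq> Inl ` V \<union> Inr ` E \<and>
     \<not> has_fpm (del_verts V F) (del_edges V E F)"

definition fsmp :: "'a set \<Rightarrow> 'a set set \<Rightarrow> nat" where
  "fsmp V E = (LEAST k. \<exists>F. fsmp_set V E F \<and> finite F \<and> card F = k)"

definition has_isolated_vertex :: "'a set \<Rightarrow> 'a set set \<Rightarrow> bool" where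
  "has_isolated_vertex V E \<longleftrightarrow> (\<exists>v\<in>V. \<forall>e\<in>E. v \<notin> e)"

text \<open>Vertices are boolean lists of length n; the head is the prefixed bit.
  Equal leading bits: adjacency inside the copy AQ_{n-1}; different leading
  bits: cross edge (rest equal) or complement edge (rest differs everywhere).
  For n = 1 this gives K_2.\<close>

fun aq_adj :: "bool list \<Rightarrow> bool list \<Rightarrow> bool" where
  "aq_adj (a # u) (b # v) =
     (length u = length v \<and>
      (if a = b then aq_adj u v
       else (u = v \<or> (\<forall>i<length u. u ! i \<noteq> v ! i))))"
| "aq_adj _ _ = False"

definition AQ_V :: "nat \<Rightarrow> bool list set" where
  "AQ_V n = {u. length u = n}"

definition AQ_E :: "nat \<Rightarrow> bool list set set" where
  "AQ_E n = {{u, v} | u v. u \<in> AQ_V n \<and> v \<in> AQ_V n \<and> aq_adj u v}"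

end

theory Submission
  imports Defs
begin

text \<open>By Hall's theorem applied to the bipartite double cover, a graph without fractional perfect
  matching has an independent set \<open>I\<close> with fewer than \<open>|I|\<close> neighbours. If this happens in
  \<open>AQ_n - F\<close>, then \<open>F\<close> contains all edges of \<open>AQ_n\<close> inside \<open>I\<close>, and for each of the outer neighbours of
  \<open>I\<close> in \<open>AQ_n\<close>, except fewer than \<open>|I|\<close> of them, either that vertex or one of its edges to \<open>I\<close>. Hence
  \<open>|F|\<close> exceeds the excess of \<open>I\<close>, which is the number of edges inside \<open>I\<close> plus the number of outer
  neighbours minus \<open>|I|\<close>. For \<open>n \<ge> 4\<close> the excess is at least \<open>2n - 2\<close> for every nonempty \<open>I\<close> and at
  least \<open>2n - 1\<close> if \<open>|I| \<ge> 2\<close>, so a fault set of size \<open>2n - 1\<close> must isolate a vertex.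

  The bound on the excess is an induction on \<open>n\<close>: the excess of \<open>I\<close> is at least the sum of the
  excesses of its two halves, and if one half is empty, the other one has at least two outer
  neighbours across. The inductive step would fail from dimension 3 to 4, because excess 2 occurs
  in \<open>AQ_3\<close>, so \<open>n = 4\<close> is settled by enumerating the pairs of subsets of \<open>AQ_3\<close>.\<close>

section \<open>Hall's marriage theorem\<close>

text \<open>A tight nonempty proper subset is matched first and the rest outside its neighbourhood;
  if no such subset is tight, any single pair may be matched and removed.\<close>

lemma hall_marriage:
  assumes "finite X" and "\<forall>x\<in>X. finite (A x)" and "\<forall>S\<subseteq>X. card S \<le> card (\<Union>x\<in>S. A x)"
  shows "\<exists>R. inj_on R X \<and> (\<forall>x\<in>X. R x \<in> A x)"
  using assms
proof (induction X arbitrary: A rule: finite_psubset_induct)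
  case (psubset X)
  note finA = psubset.prems(1)[rule_format] and hall = psubset.prems(2)[rule_format]
  show ?case
  proof (cases "\<exists>S. S \<subset> X \<and> S \<noteq> {} \<and> card (\<Union>x\<in>S. A x) \<le> card S")
    case True
    then obtain S where S: "S \<subset> X" "S \<noteq> {}" "card (\<Union>x\<in>S. A x) \<le> card S" by blast
    let ?N = "\<Union>x\<in>S. A x"
    have finS: "finite S"
      using S psubset.hyps by (blast intro: finite_subset)
    then have finN: "finite ?N"
      using S(1) finA by blast
    have "\<exists>R. inj_on R S \<and> (\<forall>x\<in>S. R x \<in> A x)"
      using S(1) finA hall by (intro psubset.IH) (auto intro: hall)
    then obtain R where R: "inj_on R S" "\<forall>x\<in>S. R x \<in> A x"
      by blast
    \<comment> \<open>Hall's condition for \<open>S \<union> T\<close> and tightness of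
      \<open>S\<close> leave at least \<open>card T\<close> elements outside
      \<open>?N\<close>.\<close>
    have "card T \<le> card (\<Union>x\<in>T. A x - ?N)" if T: "T \<subseteq> X - S" for T
    proof -
      have finT: "finite T"
        using T psubset.hyps by (blast intro: finite_subset)
      then have finNT: "finite (\<Union>x\<in>T. A x - ?N)"
        using T finA by blast
      have "card S + card T = card (S \<union> T)"
        using T finS finT by (subst card_Un_disjoint) auto
      also have "\<dots> \<le> card (\<Union>x\<in>S \<union> T. A x)"
        using T S by (intro hall) auto
      also have "(\<Union>x\<in>S \<union> T. A x) = ?N \<union> (\<Union>x\<in>T. A x - ?N)" by auto
      also have "card \<dots> = card ?N + card (\<Union>x\<in>T. A x - ?N)"
        using finN finNT by (intro card_Un_disjoint) auto
      finally show ?thesis using S(3) by simp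
    qed
    moreover have "X - S \<subset> X" using S by auto
    ultimately obtain Q where Q: "inj_on Q (X - S)" "\<forall>x\<in>X - S. Q x \<in> A x - ?N"
      using psubset.IH[of "X - S" "\<lambda>x. A x - ?N"] finA by auto
    let ?R = "\<lambda>x. if x \<in> S then R x else Q x"
    have ne: "R x \<noteq> Q y" if "x \<in> S" "y \<in> X - S" for x y
      using that R(2) Q(2) by auto
    have "inj_on ?R X"
    proof (rule inj_onI)
      fix x y assume "x \<in> X" "y \<in> X" "?R x = ?R y"
      then show "x = y"
        using R(1) Q(1) ne[of x y] ne[of y x]
        by (cases "x \<in> S"; cases "y \<in> S") (auto dest: inj_onD)
    qed
    moreover have "\<forall>x\<in>X. ?R x \<in> A x" using R Q by auto
    ultimately show ?thesis by blast
  next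
    case slack: False
    show ?thesis
    proof (cases "X = {}")
      case False
      then obtain x where x: "x \<in> X" by blast
      then have "A x \<noteq> {}" using hall[of "{x}"] by auto
      then obtain y where y: "y \<in> A x" by blast
      \<comment> \<open>Strict slack pays for the loss of \<open>y\<close>.\<close>
      have "card S \<le> card (\<Union>z\<in>S. A z - {y})" if S: "S \<subseteq> X - {x}" for S
      proof (cases "S = {}")
        case False
        moreover have "S \<subset> X" using S x by blast
        ultimately have "card S < card (\<Union>z\<in>S. A z)"
          using slack by (meson not_le)
        moreover have "(\<Union>z\<in>S. A z - {y}) = (\<Union>z\<in>S. A z) - {y}" by auto
        ultimately show ?thesis by (simp add: card_Diff_singleton_if) linarith
      qed simp
      moreover have "X - {x} \<subset> X" using x by auto
      ultimately obtain Q where Q: "inj_on Q (X - {x})" "\<forall>z\<in>X - {x}. Q z \<in> A z - {y}"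
        using psubset.IH[of "X - {x}" "\<lambda>z. A z - {y}"] finA by auto
      have "inj_on (Q(x := y)) X"
      proof (rule inj_onI)
        fix a b assume "a \<in> X" "b \<in> X" "(Q(x := y)) a = (Q(x := y)) b"
        then show "a = b"
          using Q by (cases "a = x"; cases "b = x") (auto dest: inj_onD)
      qed
      moreover have "\<forall>z\<in>X. (Q(x := y)) z \<in> A z" using Q y by auto
      ultimately show ?thesis by blast
    qed auto
  qed
qed

section \<open>Fractional perfect matchings and deficient independent sets\<close>

text \<open>Each edge gets half the number of times it occurs as \<open>{x, R x}\<close>; the orbits of \<open>R\<close> of
  length two become matching edges and the longer ones become cycles of weight one half.\<close>

lemma has_fpm_if_permutation:
  assumes fin: "finite V" and inj: "inj_on R V"
    and R: "\<And>x. x \<in> V \<Longrightarrow> R x \<in> V \<and> R x \<noteq> x \<and> {x, R x} \<in> E"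
    and E: "\<And>e. e \<in> E \<Longrightarrow> e \<subseteq> V \<and> e \<noteq> {}"
  shows "has_fpm V E"
proof -
  define f :: "'a set \<Rightarrow> real" where "f e = (\<Sum>x\<in>V. of_bool ({x, R x} = e)) / 2" for e
  have finE: "finite E"
    using E fin by (meson PowI finite_Pow_iff finite_subset subsetI)
  have img: "R ` V = V"
    using R by (intro endo_inj_surj fin inj) auto
  have deg: "(\<Sum>e\<in>{e\<in>E. v \<in> e}. f e) = 1" if v: "v \<in> V" for v
  proof -
    have "2 * (\<Sum>e\<in>{e\<in>E. v \<in> e}. f e) = (\<Sum>e\<in>{e\<in>E. v \<in> e}. \<Sum>x\<in>V. of_bool ({x, R x} = e))"
      by (simp add: f_def flip: sum_divide_distrib)
    also have "\<dots> = (\<Sum>x\<in>V. \<Sum>e\<in>{e\<in>E. v \<in> e}. of_bool ({x, R x} = e))"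
      by (rule sum.swap)
    also have "\<dots> = (\<Sum>x\<in>V. of_bool (x = v) + of_bool (R x = v))"
    proof (rule sum.cong[OF refl])
      fix x assume x: "x \<in> V"
      have "(\<Sum>e\<in>{e\<in>E. v \<in> e}. of_bool ({x, R x} = e) :: real) =
          (if {x, R x} \<in> {e\<in>E. v \<in> e} then 1 else 0)"
        using finE by (simp add: of_bool_def sum.delta' del: mem_Collect_eq)
      then show "(\<Sum>e\<in>{e\<in>E. v \<in> e}. of_bool ({x, R x} = e) :: real) = of_bool (x = v) + of_bool (R x = v)"
        using R[OF x] by auto
    qed
    \<comment> \<open>\<open>R\<close> permutes \<open>V\<close>, so \<open>v\<close> is hit once as
      \<open>x\<close> and once as \<open>R x\<close>.\<close>
    also have "\<dots> = (\<Sum>x\<in>V. of_bool (x = v)) + (\<Sum>x\<in>R ` V. of_bool (x = v))"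
      by (simp add: sum.distrib sum.reindex[OF inj] del: sum_of_bool_eq)
    also have "\<dots> = 2"
      using v fin by (simp add: img of_bool_def sum.delta del: sum_of_bool_eq)
    finally show ?thesis by simp
  qed
  have nonneg: "0 \<le> f e" for e
    by (simp add: f_def sum_nonneg)
  have "f e \<le> 1" if e: "e \<in> E" for e
  proof -
    obtain v where v: "v \<in> e" using E[OF e] by blast
    have "f e \<le> (\<Sum>e\<in>{e\<in>E. v \<in> e}. f e)"
      using e v finE nonneg by (intro member_le_sum) auto
    also have "\<dots> = 1" using deg v E[OF e] by blast
    finally show ?thesis .
  qed
  then show ?thesis
    unfolding has_fpm_def fractional_perfect_matching_def using deg nonneg by blast
qed

text \<open>Distinct representatives of all neighbourhoods would form a permutation along edges, so
  Hall's condition fails for some \<open>S\<close>.\<close>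

lemma no_fpm_imp_deficient_independent_set:
  assumes fin: "finite V" and E: "\<And>e. e \<in> E \<Longrightarrow> e \<subseteq> V \<and> card e = 2"
    and no_fpm: "\<not> has_fpm V E"
  obtains I where "I \<subseteq> V" "\<And>u v. u \<in> I \<Longrightarrow> v \<in> I \<Longrightarrow> {u, v} \<notin> E"
    "card {v\<in>V. \<exists>u\<in>I. {u, v} \<in> E} < card I"
proof -
  define N where "N S = {v\<in>V. \<exists>u\<in>S. {u, v} \<in> E}" for S
  have N_Union: "N S = (\<Union>x\<in>S. N {x})" for S by (auto simp: N_def)
  have finN: "finite (N S)" for S using fin by (simp add: N_def)
  have "\<exists>S\<subseteq>V. card (N S) < card S"
  proof (rule ccontr)
    assume "\<not> ?thesis"
    then have "\<forall>S\<subseteq>V. card S \<le> card (\<Union>x\<in>S. N {x})" by (metis N_Union leI)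
    then obtain R where R: "inj_on R V" "\<forall>x\<in>V. R x \<in> N {x}"
      using hall_marriage[of V "\<lambda>x. N {x}"] fin finN by auto
    have "R x \<in> V \<and> R x \<noteq> x \<and> {x, R x} \<in> E" if "x \<in> V" for x
      using R(2) that E[of "{x, R x}"] by (auto simp: N_def)
    moreover have "e \<subseteq> V \<and> e \<noteq> {}" if "e \<in> E" for e
      using E[OF that] by auto
    ultimately show False
      using has_fpm_if_permutation[OF fin R(1)] no_fpm by blast
  qed
  then obtain S where S: "S \<subseteq> V" "card (N S) < card S" by blast
  have finS: "finite S" using S fin finite_subset by blast
  \<comment> \<open>Discarding \<open>N S \<inter> S\<close> from both \<open>S\<close> and
    \<open>N S\<close> keeps the deficiency and makes the set independent.\<close>
  let ?I = "S - N S"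
  have indep: "{u, v} \<notin> E" if "u \<in> ?I" "v \<in> S" for u v
    using that S by (auto simp: N_def insert_commute)
  have "N ?I \<subseteq> N S - S"
    using indep by (auto simp: N_def)
  then have "card (N ?I) \<le> card (N S - S)"
    using finN by (intro card_mono) auto
  also have "\<dots> = card (N S) - card (N S \<inter> S)"
    by (rule card_Diff_subset_Int) (simp add: finN)
  also have "\<dots> < card S - card (N S \<inter> S)"
    using S(2) card_mono[OF finN, of "N S \<inter> S" S] by (intro diff_less_mono) auto
  also have "\<dots> = card ?I"
    using finS by (simp add: card_Diff_subset_Int Int_commute)
  finally show ?thesis
    using S(1) indep by (intro that[of ?I]) (auto simp only: N_def)
qed

section \<open>The excess of a vertex set and its recursion over the leading bit\<close>

text \<open>Orienting every edge towards the endpoint with the larger first differing bit lets edges be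
  counted as pairs, each of them once.\<close>

fun aq_arc :: "bool list \<Rightarrow> bool list \<Rightarrow> bool" where
  "aq_arc (a # u) (b # v) =
     (if a = b then aq_arc u v else \<not> a \<and> (u = v \<or> v = map Not u))"
| "aq_arc _ _ = False"

text \<open>Indicator sums over all vertices split directly along \<open>sum_AQ_V_Suc\<close> and
  can be evaluated.\<close>

definition arcs_in :: "nat \<Rightarrow> bool list set \<Rightarrow> int" where
  "arcs_in n I = (\<Sum>u\<in>AQ_V n. \<Sum>v\<in>AQ_V n. of_bool (u \<in> I \<and> v \<in> I \<and> aq_arc u v))"

definition aq_nbr :: "nat \<Rightarrow> bool list set \<Rightarrow> bool list \<Rightarrow> bool" where
  "aq_nbr n I u \<longleftrightarrow> (\<exists>v\<in>AQ_V n. v \<in> I \<and> aq_adj u v)"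

definition aq_excess :: "nat \<Rightarrow> bool list set \<Rightarrow> int" where
  "aq_excess n I = arcs_in n I + (\<Sum>u\<in>AQ_V n. of_bool (u \<notin> I \<and> aq_nbr n I u))
     - (\<Sum>u\<in>AQ_V n. of_bool (u \<in> I))"

definition half :: "bool \<Rightarrow> bool list set \<Rightarrow> bool list set" where
  "half b I = {u. b # u \<in> I}"

text \<open>What is added to the excesses of two halves: the edges between them, and the vertices of one half
  that are boundary only because of the other.\<close>

definition cross_gain :: "nat \<Rightarrow> bool list set \<Rightarrow> bool list set \<Rightarrow> int" where
  "cross_gain n A B =
     (\<Sum>u\<in>AQ_V n. of_bool (u \<in> A \<and> u \<in> B) + of_bool (u \<in> A \<and> map Not u \<in> B))
   + (\<Sum>u\<in>AQ_V n. of_bool (u \<notin> A \<and> \<not> aq_nbr n A u \<and> (u \<in> B \<or> map Not u \<in> B)))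
   + (\<Sum>u\<in>AQ_V n. of_bool (u \<notin> B \<and> \<not> aq_nbr n B u \<and> (u \<in> A \<or> map Not u \<in> A)))"

lemma finite_AQ_V [simp]: "finite (AQ_V n)"
  using finite_lists_length_eq[of "UNIV :: bool set" n] by (simp add: AQ_V_def)

lemma AQ_V_0: "AQ_V 0 = {[]}"
  by (auto simp: AQ_V_def)

lemma AQ_V_Suc: "AQ_V (Suc n) = Cons False ` AQ_V n \<union> Cons True ` AQ_V n"
proof -
  have "u \<in> Cons False ` AQ_V n \<union> Cons True ` AQ_V n" if "length u = Suc n" for u
    using that by (cases u; cases "hd u") (auto simp: AQ_V_def)
  then show ?thesis by (auto simp: AQ_V_def)
qed

lemma sum_AQ_V_Suc:
  "(\<Sum>u\<in>AQ_V (Suc n). f u) = (\<Sum>u\<in>AQ_V n. f (False # u)) + (\<Sum>u\<in>AQ_V n. f (True # u))"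
  unfolding AQ_V_Suc by (subst sum.union_disjoint) (auto simp: sum.reindex o_def)

lemma bex_AQ_V_Suc:
  "(\<exists>u\<in>AQ_V (Suc n). P u) \<longleftrightarrow> (\<exists>u\<in>AQ_V n. P (False # u)) \<or> (\<exists>u\<in>AQ_V n. P (True # u))"
  unfolding AQ_V_Suc by auto

lemma differ_everywhere_iff:
  "length u = length v \<Longrightarrow> (\<forall>i<length u. u ! i \<noteq> v ! i) \<longleftrightarrow> v = map Not u"
  by (auto simp: list_eq_iff_nth_eq)

lemma aq_adj_Cons:
  assumes "length u = length v"
  shows "aq_adj (a # u) (b # v) \<longleftrightarrow> (if a = b then aq_adj u v else u = v \<or> v = map Not u)"
  unfolding aq_adj.simps differ_everywhere_iff[OF assms] using assms by simp

lemma map_Not_in_AQ_V [simp]: "map Not u \<in> AQ_V n \<longleftrightarrow> u \<in> AQ_V n"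
  by (simp add: AQ_V_def)

lemma aq_nbr_Suc:
  assumes "u \<in> AQ_V n"
  shows "aq_nbr (Suc n) I (b # u) \<longleftrightarrow>
    aq_nbr n (half b I) u \<or> u \<in> half (\<not> b) I \<or> map Not u \<in> half (\<not> b) I"
proof -
  have "aq_nbr (Suc n) I (b # u) \<longleftrightarrow>
     (\<exists>v\<in>AQ_V n. v \<in> half b I \<and> aq_adj u v) \<or>
     (\<exists>v\<in>AQ_V n. v \<in> half (\<not> b) I \<and> (u = v \<or> v = map Not u))"
    using assms unfolding aq_nbr_def bex_AQ_V_Suc half_def
    by (cases b) (auto simp: aq_adj_Cons AQ_V_def simp del: aq_adj.simps)
  then show ?thesis
    using assms by (auto simp: aq_nbr_def)
qed

text \<open>All arcs between the halves leave the \<open>False\<close> half. At \<open>n = 0\<close>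
  the cross and the complement edge would coincide and be counted twice.\<close>

lemma arcs_in_Suc:
  assumes "n \<ge> 1"
  shows "arcs_in (Suc n) I = arcs_in n (half False I) + arcs_in n (half True I)
    + (\<Sum>u\<in>AQ_V n. of_bool (u \<in> half False I \<and> u \<in> half True I)
                   + of_bool (u \<in> half False I \<and> map Not u \<in> half True I))"
proof -
  have cross: "(\<Sum>v\<in>AQ_V n. of_bool (False # u \<in> I \<and> True # v \<in> I \<and> (u = v \<or> v = map Not u)) :: int)
     = of_bool (u \<in> half False I \<and> u \<in> half True I)
       + of_bool (u \<in> half False I \<and> map Not u \<in> half True I)" if "u \<in> AQ_V n" for u
  proof -
    have ne: "map Not u \<noteq> u"
      using that assms by (cases u) (auto simp: AQ_V_def)
    have "(\<Sum>v\<in>AQ_V n. of_bool (False # u \<in> I \<and> True # v \<in> I \<and> (u = v \<or> v = map Not u)) :: int)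
       = (\<Sum>v\<in>{u, map Not u}. of_bool (False # u \<in> I \<and> True # v \<in> I \<and> (u = v \<or> v = map Not u)))"
      using that by (intro sum.mono_neutral_right) auto
    also have "\<dots> = of_bool (u \<in> half False I \<and> u \<in> half True I)
       + of_bool (u \<in> half False I \<and> map Not u \<in> half True I)"
      using ne by (subst sum.insert) (auto simp: half_def)
    finally show ?thesis .
  qed
  show ?thesis
    unfolding arcs_in_def sum_AQ_V_Suc
    by (simp add: cross sum.distrib half_def cong: sum.cong_simp del: sum_of_bool_eq)
qed

lemma aq_excess_Suc:
  assumes "n \<ge> 1"
  shows "aq_excess (Suc n) I = aq_excess n (half False I) + aq_excess n (half True I)
    + cross_gain n (half False I) (half True I)"
proof -
  \<comment> \<open>A boundary vertex either has a neighbour in its own half of \<open>I\<close> or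
    is boundary only through the other half; \<open>cross_gain\<close> collects the second
    kind.\<close>
  have split: "(\<Sum>u\<in>AQ_V n. of_bool (b # u \<notin> I \<and> aq_nbr (Suc n) I (b # u)) :: int) =
    (\<Sum>u\<in>AQ_V n. of_bool (u \<notin> half b I \<and> aq_nbr n (half b I) u)) +
    (\<Sum>u\<in>AQ_V n. of_bool (u \<notin> half b I \<and> \<not> aq_nbr n (half b I) u \<and>
        (u \<in> half (\<not> b) I \<or> map Not u \<in> half (\<not> b) I)))" for b
    unfolding sum.distrib[symmetric]
    by (rule sum.cong) (auto simp: aq_nbr_Suc half_def)
  show ?thesis
    unfolding aq_excess_def cross_gain_def arcs_in_Suc[OF assms] sum_AQ_V_Suc split
    by (simp add: half_def)
qed

section \<open>Evaluation in dimension 3\<close>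

lemma AQ_V_code [code]: "AQ_V n = set (List.n_lists n [False, True])"
  by (auto simp: AQ_V_def set_n_lists)

lemma aq_adj_code [code]:
  "aq_adj [] v = False" "aq_adj u [] = False"
  "aq_adj (a # u) (b # v) \<longleftrightarrow>
     length u = length v \<and> (if a = b then aq_adj u v else u = v \<or> v = map Not u)"
proof -
  show "aq_adj [] v = False" by simp
  show "aq_adj u [] = False" by (cases u) simp_all
  show "aq_adj (a # u) (b # v) \<longleftrightarrow>
     length u = length v \<and> (if a = b then aq_adj u v else u = v \<or> v = map Not u)"
    using aq_adj_Cons[of u v a b] by (metis aq_adj.simps(1))
qed

text \<open>The table is a constant of its own so that simplification computes each entry only once.\<close>

definition aq3_table :: "(bool list list \<times> int \<times> nat) list" where
  "aq3_table = map (\<lambda>xs. (xs, aq_excess 3 (set xs), length xs))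
     (subseqs (List.n_lists 3 [False, True]))"

text \<open>If both halves have excess at least four there is nothing to prove, so only pairs with one half
  of excess at most three (fifteen sets, the empty one included) are enumerated.\<close>

lemma aq3_table_low_excess:
  "\<forall>(xs, e, c)\<in>set aq3_table. e \<le> 3 \<longrightarrow> (\<forall>(ys, e', c')\<in>set aq3_table.
      let r = (if c + c' \<ge> 2 then 7 else if c + c' \<ge> 1 then 6 else 0) in
      r \<le> e + e' \<or> r \<le> e + e' + cross_gain 3 (set xs) (set ys))"
  by code_simp

section \<open>The lower bound on the excess\<close>

text \<open>Complementation is an involution of \<open>AQ_V n\<close>. The symmetry allows the half
  of low excess to be taken first.\<close>

lemma cross_gain_commute: "cross_gain n A B = cross_gain n B A"
proof -
  have bij: "bij_betw (map Not) (AQ_V n) (AQ_V n)"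
    by (rule bij_betw_byWitness[where f' = "map Not"]) (auto simp: o_def)
  have "(\<Sum>u\<in>AQ_V n. of_bool (u \<in> A \<and> map Not u \<in> B) :: int)
      = (\<Sum>u\<in>AQ_V n. of_bool (map Not u \<in> A \<and> u \<in> B))"
    by (subst sum.reindex_bij_betw[OF bij, symmetric]) (simp add: o_def del: sum_of_bool_eq)
  then show ?thesis
    by (simp add: cross_gain_def sum.distrib conj_commute del: sum_of_bool_eq)
qed

lemma cross_gain_nonneg: "cross_gain n A B \<ge> 0"
  unfolding cross_gain_def by (intro add_nonneg_nonneg sum_nonneg) auto

text \<open>A vertex \<open>u\<close> of \<open>A\<close> makes \<open>u\<close> and its complement
  boundary vertices of the empty half. These two supply the growth of the bound per
  dimension.\<close>

lemma cross_gain_empty_ge_2: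
  assumes "n \<ge> 1" "A \<noteq> {}" "A \<subseteq> AQ_V n"
  shows "cross_gain n A {} \<ge> 2"
proof -
  obtain u where u: "u \<in> A" "u \<in> AQ_V n" using assms by blast
  have "u \<noteq> map Not u"
    using u(2) assms(1) by (cases u) (auto simp: AQ_V_def)
  then have "(2 :: int) = (\<Sum>w\<in>{u, map Not u}. of_bool (w \<in> A \<or> map Not w \<in> A))"
    using u by (simp add: o_def)
  also have "\<dots> \<le> (\<Sum>w\<in>AQ_V n. of_bool (w \<in> A \<or> map Not w \<in> A))"
    using u by (intro sum_mono2) auto
  also have "\<dots> \<le> cross_gain n A {}"
    by (simp add: cross_gain_def aq_nbr_def)
  finally show ?thesis .
qed

lemma half_subset: "I \<subseteq> AQ_V (Suc n) \<Longrightarrow> half b I \<subseteq> AQ_V n"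
  by (auto simp: half_def AQ_V_def)

lemma card_halves:
  assumes "I \<subseteq> AQ_V (Suc n)"
  shows "card I = card (half False I) + card (half True I)"
proof -
  have eq: "I = Cons False ` half False I \<union> Cons True ` half True I"
    using assms by (auto simp: half_def AQ_V_Suc)
  have fin: "finite (half b I)" for b
    using half_subset[OF assms] finite_AQ_V by (rule finite_subset)
  have "card I = card (Cons False ` half False I \<union> Cons True ` half True I)"
    using eq by (rule arg_cong)
  also have "\<dots> = card (half False I) + card (half True I)"
    by (subst card_Un_disjoint) (auto simp: fin card_image)
  finally show ?thesis .
qed

text \<open>The left side is the excess of the subset of \<open>AQ_V 4\<close> with halves
  \<open>A\<close> and \<open>B\<close>; 6 and 7 are \<open>2 * n - 2\<close> and
  \<open>2 * n - 1\<close> at \<open>n = 4\<close>.\<close>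

lemma aq_excess_4:
  assumes "A \<subseteq> AQ_V 3" "B \<subseteq> AQ_V 3"
  shows "card A + card B \<ge> 1 \<Longrightarrow> aq_excess 3 A + aq_excess 3 B + cross_gain 3 A B \<ge> 6"
    and "card A + card B \<ge> 2 \<Longrightarrow> aq_excess 3 A + aq_excess 3 B + cross_gain 3 A B \<ge> 7"
proof -
  have tab: "\<exists>xs. set xs = A \<and> (xs, aq_excess 3 A, card A) \<in> set aq3_table" if A: "A \<subseteq> AQ_V 3" for A
  proof -
    let ?W = "List.n_lists 3 [False, True]"
    have "A \<in> set ` set (subseqs ?W)"
      using A by (simp add: subseqs_powset AQ_V_code)
    then obtain xs where xs: "xs \<in> set (subseqs ?W)" "set xs = A" by blast
    have "distinct ?W" by (simp add: distinct_n_lists)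
    then have "distinct xs" using xs(1) by (simp add: subseqs_distinctD)
    then have "length xs = card A" using xs(2) by (simp add: distinct_card[symmetric])
    then show ?thesis using xs by (auto simp: aq3_table_def image_iff)
  qed
  have key: "(if card A + card B \<ge> 2 then 7 else if card A + card B \<ge> 1 then 6 else 0)
      \<le> aq_excess 3 A + aq_excess 3 B + cross_gain 3 A B"
    if A: "A \<subseteq> AQ_V 3" and B: "B \<subseteq> AQ_V 3" and le: "aq_excess 3 A \<le> 3" for A B
  proof -
    obtain xs ys where *: "set xs = A" "(xs, aq_excess 3 A, card A) \<in> set aq3_table"
      "set ys = B" "(ys, aq_excess 3 B, card B) \<in> set aq3_table"
      using tab[OF A] tab[OF B] by blast
    \<comment> \<open>Where the table gives the bound without the gain, nonnegativity of the gain
      suffices.\<close>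
    show ?thesis
      using aq3_table_low_excess * le cross_gain_nonneg[of 3 A B] by (fastforce simp: Let_def)
  qed
  have "(if card A + card B \<ge> 2 then 7 else if card A + card B \<ge> 1 then 6 else 0)
      \<le> aq_excess 3 A + aq_excess 3 B + cross_gain 3 A B"
  proof (cases "aq_excess 3 A \<le> 3 \<or> aq_excess 3 B \<le> 3")
    case True
    then show ?thesis
      using key[OF assms] key[OF assms(2,1)] by (auto simp: cross_gain_commute add.commute)
  next
    case False
    then show ?thesis using cross_gain_nonneg[of 3 A B] by auto
  qed
  then show "card A + card B \<ge> 1 \<Longrightarrow> aq_excess 3 A + aq_excess 3 B + cross_gain 3 A B \<ge> 6"
    and "card A + card B \<ge> 2 \<Longrightarrow> aq_excess 3 A + aq_excess 3 B + cross_gain 3 A B \<ge> 7"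
    by (auto split: if_splits)
qed

text \<open>The first bound is what a single vertex attains: \<open>2 * n - 1\<close> neighbours
  minus one.\<close>

lemma aq_excess_ge:
  assumes "n \<ge> 4" "I \<subseteq> AQ_V n" "I \<noteq> {}"
  shows "aq_excess n I \<ge> 2 * int n - 2 \<and> (card I \<ge> 2 \<longrightarrow> aq_excess n I \<ge> 2 * int n - 1)"
  using assms
proof (induction n arbitrary: I rule: nat_induct_at_least)
  case base
  have I: "I \<subseteq> AQ_V (Suc 3)" using base by simp
  have "card I \<ge> 1"
    using base finite_subset[OF base(1)] by (simp add: Suc_le_eq card_gt_0_iff)
  moreover have "aq_excess 4 I = aq_excess 3 (half False I) + aq_excess 3 (half True I)
    + cross_gain 3 (half False I) (half True I)"
    using aq_excess_Suc[of 3 I] by simp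
  ultimately show ?case
    using aq_excess_4[OF half_subset[OF I] half_subset[OF I], of False True] card_halves[OF I] by auto
next
  case (Suc n)
  let ?A = "half False I" and ?B = "half True I"
  have sub: "?A \<subseteq> AQ_V n" "?B \<subseteq> AQ_V n" by (simp_all add: half_subset[OF Suc.prems(1)])
  have rec: "aq_excess (Suc n) I = aq_excess n ?A + aq_excess n ?B + cross_gain n ?A ?B"
    using Suc.hyps by (intro aq_excess_Suc) simp
  have card: "card I = card ?A + card ?B" by (rule card_halves[OF Suc.prems(1)])
  have empty: "aq_excess n {} = 0" by (simp add: aq_excess_def arcs_in_def aq_nbr_def)
  have "?A \<noteq> {} \<or> ?B \<noteq> {}"
    using Suc.prems by (fastforce simp: half_def AQ_V_Suc)
  then consider "?A \<noteq> {}" "?B \<noteq> {}" | "?A \<noteq> {}" "?B = {}" | "?A = {}" "?B \<noteq> {}" by blast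
  then show ?case
  proof cases
    \<comment> \<open>Each half contributes \<open>2 * n - 2\<close>, and \<open>4 * n - 4\<close>
      is at least \<open>2 * (n + 1) - 1\<close>.\<close>
    case 1
    then show ?thesis
      using Suc.IH[OF sub(1)] Suc.IH[OF sub(2)] rec cross_gain_nonneg[of n ?A ?B] Suc.hyps by auto
  next
    \<comment> \<open>The empty half has excess 0, and the gain of 2 carries both bounds to
      \<open>Suc n\<close>.\<close>
    case 2
    then show ?thesis
      using Suc.IH[OF sub(1)] rec card empty cross_gain_empty_ge_2[OF _ 2(1) sub(1)] Suc.hyps by auto
  next
    case 3
    then show ?thesis
      using Suc.IH[OF sub(2)] rec card empty cross_gain_empty_ge_2[OF _ 3(2) sub(2)] Suc.hyps
        cross_gain_commute[of n "{}" ?B] by auto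
  qed
qed

section \<open>Counting faults against the excess\<close>

lemma aq_adj_sym: "aq_adj u v \<Longrightarrow> aq_adj v u"
  by (induction u v rule: aq_adj.induct) (auto split: if_splits)

lemma aq_adj_irrefl: "\<not> aq_adj u u"
  by (induction u) auto

lemma aq_arc_imp_adj: "length u = length v \<Longrightarrow> aq_arc u v \<Longrightarrow> aq_adj u v"
  by (induction u v rule: aq_arc.induct) (auto split: if_splits)

lemma aq_arc_asym: "aq_arc u v \<Longrightarrow> \<not> aq_arc v u"
  by (induction u v rule: aq_arc.induct) (auto split: if_splits)

lemma mem_AQ_E: "{u, v} \<in> AQ_E n \<longleftrightarrow> u \<in> AQ_V n \<and> v \<in> AQ_V n \<and> aq_adj u v"
  unfolding AQ_E_def by (auto simp: doubleton_eq_iff dest: aq_adj_sym)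

lemma AQ_E_edge: "e \<in> AQ_E n \<Longrightarrow> e \<subseteq> AQ_V n \<and> card e = 2"
  unfolding AQ_E_def using aq_adj_irrefl by (auto simp: card_insert_if)

lemma aq_excess_eq_card:
  assumes "I \<subseteq> AQ_V n"
  shows "aq_excess n I = int (card {(u, v) \<in> I \<times> I. aq_arc u v})
    + int (card {u \<in> AQ_V n - I. \<exists>v\<in>I. aq_adj u v}) - int (card I)"
proof -
  have "arcs_in n I = (\<Sum>p\<in>AQ_V n \<times> AQ_V n. of_bool (fst p \<in> I \<and> snd p \<in> I \<and> aq_arc (fst p) (snd p)))"
    by (simp add: arcs_in_def sum.cartesian_product case_prod_unfold del: sum_of_bool_eq)
  also have "\<dots> = int (card (AQ_V n \<times> AQ_V n \<inter> {p. fst p \<in> I \<and> snd p \<in> I \<and> aq_arc (fst p) (snd p)}))"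
    by simp
  also have "AQ_V n \<times> AQ_V n \<inter> {p. fst p \<in> I \<and> snd p \<in> I \<and> aq_arc (fst p) (snd p)}
      = {(u, v) \<in> I \<times> I. aq_arc u v}"
    using assms by auto
  finally have arcs: "arcs_in n I = int (card {(u, v) \<in> I \<times> I. aq_arc u v})" .
  have "AQ_V n \<inter> {u. u \<notin> I \<and> aq_nbr n I u} = {u \<in> AQ_V n - I. \<exists>v\<in>I. aq_adj u v}"
    using assms by (auto simp: aq_nbr_def)
  moreover have "AQ_V n \<inter> {u. u \<in> I} = I" using assms by auto
  ultimately show ?thesis by (simp add: aq_excess_def arcs)
qed

text \<open>Arcs inside \<open>I\<close> and lost outer neighbours are mapped injectively, with
  disjoint images, to faults; fewer than \<open>card I\<close> neighbours survive.\<close>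

lemma aq_excess_less_card_faults:
  assumes F: "finite F" and I: "I \<subseteq> del_verts (AQ_V n) F"
    and indep: "\<And>u v. u \<in> I \<Longrightarrow> v \<in> I \<Longrightarrow> {u, v} \<notin> del_edges (AQ_V n) (AQ_E n) F"
    and deficient: "card {v \<in> del_verts (AQ_V n) F. \<exists>u\<in>I. {u, v} \<in> del_edges (AQ_V n) (AQ_E n) F} < card I"
  shows "aq_excess n I < int (card F)"
proof -
  define V' E' where "V' = del_verts (AQ_V n) F" and "E' = del_edges (AQ_V n) (AQ_E n) F"
  define T where "T = {v \<in> V'. \<exists>u\<in>I. {u, v} \<in> E'}"
  define P where "P = {(u, v) \<in> I \<times> I. aq_arc u v}"
  define D where "D = {u \<in> AQ_V n - I. \<exists>v\<in>I. aq_adj u v}"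
  have IV: "I \<subseteq> AQ_V n" using I by (auto simp: del_verts_def)
  have finV': "finite V'" by (simp add: V'_def del_verts_def)
  have fault_edge: "Inr {u, v} \<in> F" if "u \<in> V'" "v \<in> V'" "aq_adj u v" "{u, v} \<notin> E'" for u v
    using that by (auto simp: E'_def V'_def del_edges_def del_verts_def mem_AQ_E)
  have "\<exists>z\<in>F. z = Inl x \<or> (\<exists>u\<in>I. z = Inr {x, u})" if x: "x \<in> D - T" for x
  proof (cases "Inl x \<in> F")
    case False
    obtain u where u: "u \<in> I" "aq_adj x u" using x by (auto simp: D_def)
    have "x \<in> V'" using False x by (simp add: V'_def del_verts_def D_def)
    moreover from this have "{x, u} \<notin> E'" using x u by (auto simp: T_def insert_commute)
    ultimately show ?thesis using fault_edge[of x u] u I by (auto simp: V'_def)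
  qed auto
  then obtain h where h: "\<And>x. x \<in> D - T \<Longrightarrow> h x \<in> F"
    "\<And>x. x \<in> D - T \<Longrightarrow> h x = Inl x \<or> (\<exists>u\<in>I. h x = Inr {x, u})"
    by metis
  have notI: "x \<notin> I" if "x \<in> D - T" for x using that by (simp add: D_def)
  \<comment> \<open>A vertex fault is \<open>x\<close> itself; an edge fault has \<open>x\<close> as
    its only end outside \<open>I\<close>.\<close>
  have inj_h: "inj_on h (D - T)"
  proof (rule inj_onI)
    fix x y assume "x \<in> D - T" "y \<in> D - T" "h x = h y"
    then show "x = y"
      using h(2)[of x] h(2)[of y] notI[of x] notI[of y] by (auto simp: doubleton_eq_iff)
  qed
  define k :: "bool list \<times> bool list \<Rightarrow> bool list + bool list set" where "k = (\<lambda>(u, v). Inr {u, v})"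
  have inj_k: "inj_on k P"
  proof (rule inj_onI)
    fix p q assume p: "p \<in> P" and q: "q \<in> P" and eq: "k p = k q"
    obtain a b c d where ab: "p = (a, b)" and cd: "q = (c, d)" by (cases p, cases q)
    have "aq_arc a b" "aq_arc c d" "{a, b} = {c, d}"
      using p q eq by (simp_all add: ab cd k_def P_def)
    then show "p = q"
      using aq_arc_asym[of a b] by (metis ab cd doubleton_eq_iff)
  qed
  have kF: "k ` P \<subseteq> F"
  proof
    fix z assume "z \<in> k ` P"
    then obtain u v where uv: "u \<in> I" "v \<in> I" "aq_arc u v" "z = Inr {u, v}"
      by (auto simp: k_def P_def)
    then have "aq_adj u v"
      using IV by (intro aq_arc_imp_adj) (auto simp: AQ_V_def)
    then show "z \<in> F"
      using fault_edge[of u v] uv I indep by (auto simp: V'_def E'_def)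
  qed
  have finP: "finite P"
    using finite_subset[OF IV] by (auto simp: P_def intro: finite_subset[of _ "I \<times> I"])
  have finD: "finite D" by (simp add: D_def)
  \<comment> \<open>Edges chosen by \<open>k\<close> lie inside \<open>I\<close>, those chosen by
    \<open>h\<close> leave it.\<close>
  have "k ` P \<inter> h ` (D - T) = {}"
    using h(2) notI by (fastforce simp: k_def P_def doubleton_eq_iff)
  then have "card P + card (D - T) = card (k ` P \<union> h ` (D - T))"
    using finP finD by (simp add: card_Un_disjoint card_image inj_h inj_k)
  also have "\<dots> \<le> card F"
    using kF h(1) F by (intro card_mono) auto
  finally have "card P + card (D - T) \<le> card F" .
  moreover have "card D - card T \<le> card (D - T)"
    using finV' by (intro diff_card_le_card_Diff) (simp add: T_def)
  moreover have "card T < card I" using deficient by (simp add: T_def V'_def E'_def)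
  ultimately show ?thesis
    using aq_excess_eq_card[OF IV] by (simp add: P_def D_def)
qed

lemma fsmp_set_AQ:
  assumes n: "n \<ge> 4" and F: "fsmp_set (AQ_V n) (AQ_E n) F"
  shows "card F \<ge> 2 * n - 1"
    and "card F = 2 * n - 1 \<Longrightarrow>
      has_isolated_vertex (del_verts (AQ_V n) F) (del_edges (AQ_V n) (AQ_E n) F)"
proof -
  let ?V = "del_verts (AQ_V n) F" and ?E = "del_edges (AQ_V n) (AQ_E n) F"
  have "finite (AQ_E n)"
    using AQ_E_edge finite_AQ_V by (meson PowI finite_Pow_iff finite_subset subsetI)
  then have finF: "finite F"
    using F by (auto simp: fsmp_set_def intro: finite_subset)
  have edge: "e \<subseteq> ?V \<and> card e = 2" if "e \<in> ?E" for e
    using that AQ_E_edge by (auto simp: del_edges_def)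
  have finV: "finite ?V" by (simp add: del_verts_def)
  obtain I where I: "I \<subseteq> ?V" "\<And>u v. u \<in> I \<Longrightarrow> v \<in> I \<Longrightarrow> {u, v} \<notin> ?E"
    "card {v \<in> ?V. \<exists>u\<in>I. {u, v} \<in> ?E} < card I"
    using no_fpm_imp_deficient_independent_set[OF finV edge] F by (auto simp: fsmp_set_def)
  have less: "aq_excess n I < int (card F)"
    by (rule aq_excess_less_card_faults[OF finF I])
  have "I \<subseteq> AQ_V n" "I \<noteq> {}" using I by (auto simp: del_verts_def)
  note ge = aq_excess_ge[OF n this]
  show "card F \<ge> 2 * n - 1" using ge less by linarith
  show "has_isolated_vertex ?V ?E" if "card F = 2 * n - 1"
  proof -
    have "int (card F) = 2 * int n - 1" using that n by simp
    \<comment> \<open>The excess is now at most \<open>2 * n - 2\<close>, which excludes larger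
      sets; a single vertex with fewer than one neighbour is isolated.\<close>
    then have "\<not> 2 \<le> card I" using ge less by linarith
    then have "card I = 1" using I(3) by linarith
    then obtain v where v: "I = {v}" by (auto simp: card_1_singleton_iff)
    have "card {w \<in> ?V. {v, w} \<in> ?E} = 0" using I(3) v by simp
    then have nbr: "{w \<in> ?V. {v, w} \<in> ?E} = {}" using finV by simp
    have "v \<notin> e" if e: "e \<in> ?E" for e
    proof
      assume "v \<in> e"
      moreover obtain a b where "e = {a, b}" using edge[OF e] by (auto simp: card_2_iff)
      ultimately obtain w where "e = {v, w}" by auto
      then show False using nbr e edge[OF e] by auto
    qed
    then show ?thesis using I(1) v by (auto simp: has_isolated_vertex_def)
  qed
qed

section \<open>A fault set that isolates a vertex\<close>

lemma card_aq_adj_le: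
  "finite {v. length v = length u \<and> aq_adj u v} \<and>
   card {v. length v = length u \<and> aq_adj u v} \<le> 2 * length u - 1"
proof (induction u)
  case (Cons b u)
  show ?case
  proof (cases "u = []")
    \<comment> \<open>At length 1 the two edges across coincide, so only one neighbour is added
      here; every later bit adds two.\<close>
    case True
    have sub: "{v. length v = length (b # u) \<and> aq_adj (b # u) v} \<subseteq> {[\<not> b]}"
      using True by (auto simp: length_Suc_conv split: if_splits)
    show ?thesis using True finite_subset[OF sub] card_mono[OF _ sub] by simp
  next
    case False
    let ?N = "{v. length v = length u \<and> aq_adj u v}"
    have sub: "{v. length v = length (b # u) \<and> aq_adj (b # u) v}
        \<subseteq> Cons b ` ?N \<union> {(\<not> b) # u, (\<not> b) # map Not u}"
      by (auto simp: length_Suc_conv aq_adj_Cons simp del: aq_adj.simps split: if_splits)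
    have fin: "finite (Cons b ` ?N \<union> {(\<not> b) # u, (\<not> b) # map Not u})"
      using Cons.IH by simp
    have "card (Cons b ` ?N \<union> {(\<not> b) # u, (\<not> b) # map Not u})
        \<le> card (Cons b ` ?N) + card {(\<not> b) # u, (\<not> b) # map Not u}"
      by (rule card_Un_le)
    also have "\<dots> \<le> (2 * length u - 1) + 2"
      using Cons.IH by (intro add_mono) (auto simp: card_image card_insert_if)
    also have "\<dots> = 2 * length (b # u) - 1" using False by (cases u) auto
    finally show ?thesis
      using card_mono[OF fin sub] finite_subset[OF sub fin] by linarith
  qed
qed simp

text \<open>All neighbours of the all-\<open>False\<close> vertex are deleted, so its edge sum is
  empty and cannot be 1. Equality of the size follows later from the lower bound.\<close>

lemma ex_fsmp_set_AQ:
  "\<exists>F. fsmp_set (AQ_V n) (AQ_E n) F \<and> finite F \<and> card F \<le> 2 * n - 1"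
proof -
  define u where "u = replicate n False"
  define N where "N = {v. length v = length u \<and> aq_adj u v}"
  let ?F = "Inl ` N :: (bool list + bool list set) set"
  have u: "u \<in> AQ_V n" by (simp add: u_def AQ_V_def)
  have N: "finite N" "card N \<le> 2 * n - 1"
    using card_aq_adj_le[of u] by (auto simp: N_def u_def)
  have uV: "u \<in> del_verts (AQ_V n) ?F"
    using u aq_adj_irrefl by (auto simp: del_verts_def N_def)
  have "u \<notin> e" if "e \<in> del_edges (AQ_V n) (AQ_E n) ?F" for e
  proof
    assume "u \<in> e"
    with that obtain v where "e = {u, v}" "v \<in> AQ_V n" "aq_adj u v"
      by (auto simp: del_edges_def AQ_E_def dest: aq_adj_sym)
    then show False
      using that u by (auto simp: del_edges_def del_verts_def N_def AQ_V_def)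
  qed
  then have none: "{e \<in> del_edges (AQ_V n) (AQ_E n) ?F. u \<in> e} = {}" by blast
  have "\<not> has_fpm (del_verts (AQ_V n) ?F) (del_edges (AQ_V n) (AQ_E n) ?F)"
  proof
    assume "has_fpm (del_verts (AQ_V n) ?F) (del_edges (AQ_V n) (AQ_E n) ?F)"
    then obtain f where "(\<Sum>e\<in>{e \<in> del_edges (AQ_V n) (AQ_E n) ?F. u \<in> e}. f e) = (1 :: real)"
      using uV by (auto simp: has_fpm_def fractional_perfect_matching_def)
    then show False unfolding none by simp
  qed
  moreover have "N \<subseteq> AQ_V n" by (auto simp: N_def u_def AQ_V_def)
  ultimately have "fsmp_set (AQ_V n) (AQ_E n) ?F" by (auto simp: fsmp_set_def)
  then show ?thesis
    using N by (intro exI[of _ ?F]) (simp add: card_image)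
qed

theorem theorem3p9:
  fixes n :: nat
  assumes "n \<ge> 4"
  shows "fsmp (AQ_V n) (AQ_E n) = 2 * n - 1 \<and>
         (\<forall>F. fsmp_set (AQ_V n) (AQ_E n) F \<and> card F = 2 * n - 1 \<longrightarrow>
              has_isolated_vertex (del_verts (AQ_V n) F) (del_edges (AQ_V n) (AQ_E n) F))"
proof -
  have "fsmp (AQ_V n) (AQ_E n) = 2 * n - 1"
    unfolding fsmp_def
  proof (rule Least_equality)
    show "\<exists>F. fsmp_set (AQ_V n) (AQ_E n) F \<and> finite F \<and> card F = 2 * n - 1"
      using ex_fsmp_set_AQ[of n] fsmp_set_AQ(1)[OF assms] le_antisym by metis
  qed (use fsmp_set_AQ(1)[OF assms] in blast)
  then show ?thesis using fsmp_set_AQ(2)[OF assms] by blast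
qed

end
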